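(* Let $T$ be a tree. The space $\mathcal{X}_T$ is bisequential if and only if $T$ satisfies both of the following conditions: (1) $T$ has cardinality strictly less than the first measurable cardinal; (2) $T$ has no uncountable branches.
   Context: A tree is a partially ordered set $(T,<)$ such that for every $t\in T$ the set $\{s\in T: s<t\}$ is well-ordered by $<$. A branch of $T$ is a maximal chain (maximal totally ordered subset). A partial function $f:T\to T$ is strictly decreasing if for all $s<t$ in the domain of $f$ one has $f(t)<f(s)$. It is strongly strictly decreasing if it is strictly decreasing and its domain is a totally ordered subset of $T$. The empty function is allowed. Define $$\mathcal{X}_T=\{1_F\in\{0,1\}^{T\times T}: F \text{ is the graph of a strongly strictly decreasing partial function } T\to T\},$$ with the subspace topology inherited from the product topology on $\{0,1\}^{T\times T}$; here $1_F$ is the characteristic function of $F\subset T\times T$. Bisequentiality: a sequence $\{A_n\}_{n\in\omega}$ of non-empty subsets of a topological space $X$ converges to $x\in X$ if for every neighborhood $U$ of $x$ there is $n_0\in\omega$ with $A_n\subset U$ for all $n>n_0$. An ultrafilter $\mathcal{U}\subset\mathcal{P}(X)$ converges to $x$ if every neighborhood of $x$ belongs to $\mathcal{U}$. $X$ is bisequential at $x$ if every ultrafilter on $X$ converging to $x$ contains a decreasing sequence $\{U_n\}_{n\in\omega}$ converging to $x$; $X$ is bisequential if it is bisequential at each of its points. A cardinal $\kappa$ is measurable if it is uncountable and there exists a $\kappa$-complete nonprincipal ultrafilter on $\kappa$. If no measurable cardinal exists, condition (1) is regarded as satisfied by every tree. *)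

theory Defs
  imports "HOL-Analysis.Analysis"
begin

unbundle cardinal_syntax

definition tree_on :: "'a set \<Rightarrow> ('a \<Rightarrow> 'a \<Rightarrow> bool) \<Rightarrow> bool" where
  "tree_on T lt \<longleftrightarrow>
     irreflp_on T lt \<and> transp_on T lt \<and>
     (\<forall>t\<in>T. totalp_on {s \<in> T. lt s t} lt \<and> wfp_on {s \<in> T. lt s t} lt)"

text \<open>The library predicates \<open>pred_on.chain\<close> and \<open>pred_on.maxchain\<close> compare elements by the
  reflexive closure of the given relation, so they can be fed a strict order.\<close>

definition branch :: "'a set \<Rightarrow> ('a \<Rightarrow> 'a \<Rightarrow> bool) \<Rightarrow> 'a set \<Rightarrow> bool" where
  "branch T lt B \<longleftrightarrow> pred_on.maxchain T lt B"

definition strictly_decreasing :: "('a \<Rightarrow> 'a \<Rightarrow> bool) \<Rightarrow> ('a \<rightharpoonup> 'a) \<Rightarrow> bool" where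
  "strictly_decreasing lt f \<longleftrightarrow>
     (\<forall>s\<in>dom f. \<forall>t\<in>dom f. lt s t \<longrightarrow> lt (the (f t)) (the (f s)))"

definition strongly_strictly_decreasing ::
    "'a set \<Rightarrow> ('a \<Rightarrow> 'a \<Rightarrow> bool) \<Rightarrow> ('a \<rightharpoonup> 'a) \<Rightarrow> bool" where
  "strongly_strictly_decreasing T lt f \<longleftrightarrow>
     strictly_decreasing lt f \<and> pred_on.chain T lt (dom f)"

text \<open>Points of \<open>{0,1}\<^bsup>T \<times> T\<^esup>\<close> are the extensional functions on \<open>T \<times> T\<close>, as required by
  \<^const>\<open>product_topology\<close>; hence the restriction of the characteristic function.\<close>

definition X_set :: "'a set \<Rightarrow> ('a \<Rightarrow> 'a \<Rightarrow> bool) \<Rightarrow> ('a \<times> 'a \<Rightarrow> nat) set" where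
  "X_set T lt =
     {restrict (indicator (Map.graph f)) (T \<times> T) | f.
        dom f \<subseteq> T \<and> ran f \<subseteq> T \<and> strongly_strictly_decreasing T lt f}"

definition X_space :: "'a set \<Rightarrow> ('a \<Rightarrow> 'a \<Rightarrow> bool) \<Rightarrow> ('a \<times> 'a \<Rightarrow> nat) topology" where
  "X_space T lt =
     subtopology (product_topology (\<lambda>_. discrete_topology {0, 1}) (T \<times> T)) (X_set T lt)"

definition neighborhood :: "'a topology \<Rightarrow> 'a \<Rightarrow> 'a set \<Rightarrow> bool" where
  "neighborhood X x N \<longleftrightarrow> N \<subseteq> topspace X \<and> (\<exists>V. openin X V \<and> x \<in> V \<and> V \<subseteq> N)"

definition sets_converge :: "'a topology \<Rightarrow> (nat \<Rightarrow> 'a set) \<Rightarrow> 'a \<Rightarrow> bool" where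
  "sets_converge X A x \<longleftrightarrow>
     (\<forall>n. A n \<noteq> {} \<and> A n \<subseteq> topspace X) \<and>
     (\<forall>N. neighborhood X x N \<longrightarrow> (\<exists>n0. \<forall>n>n0. A n \<subseteq> N))"

definition ultrafilter_on :: "'a set \<Rightarrow> 'a set set \<Rightarrow> bool" where
  "ultrafilter_on S \<U> \<longleftrightarrow>
     \<U> \<subseteq> Pow S \<and> S \<in> \<U> \<and> {} \<notin> \<U> \<and>
     (\<forall>A\<in>\<U>. \<forall>B\<in>\<U>. A \<inter> B \<in> \<U>) \<and>
     (\<forall>A\<in>\<U>. \<forall>B. A \<subseteq> B \<and> B \<subseteq> S \<longrightarrow> B \<in> \<U>) \<and>
     (\<forall>A. A \<subseteq> S \<longrightarrow> A \<in> \<U> \<or> S - A \<in> \<U>)"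

definition ultrafilter_converges :: "'a topology \<Rightarrow> 'a set set \<Rightarrow> 'a \<Rightarrow> bool" where
  "ultrafilter_converges X \<U> x \<longleftrightarrow> (\<forall>N. neighborhood X x N \<longrightarrow> N \<in> \<U>)"

definition bisequential_at :: "'a topology \<Rightarrow> 'a \<Rightarrow> bool" where
  "bisequential_at X x \<longleftrightarrow>
     (\<forall>\<U>. ultrafilter_on (topspace X) \<U> \<and> ultrafilter_converges X \<U> x \<longrightarrow>
        (\<exists>U :: nat \<Rightarrow> 'a set. (\<forall>n. U n \<in> \<U>) \<and> decseq U \<and> sets_converge X U x))"

definition bisequential :: "'a topology \<Rightarrow> bool" where
  "bisequential X \<longleftrightarrow> (\<forall>x\<in>topspace X. bisequential_at X x)"

definition nonprincipal :: "'a set \<Rightarrow> 'a set set \<Rightarrow> bool" where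
  "nonprincipal S \<U> \<longleftrightarrow> \<not> (\<exists>a\<in>S. \<U> = {A. A \<subseteq> S \<and> a \<in> A})"

text \<open>A cardinal is represented, as in the library, by a cardinal order \<open>\<kappa>\<close> with underlying
  set \<^term>\<open>Field \<kappa>\<close>. Empty families are excluded since \<open>\<Inter>{}\<close> is the whole type.\<close>

definition complete_family :: "'k rel \<Rightarrow> 'a set set \<Rightarrow> bool" where
  "complete_family \<kappa> \<U> \<longleftrightarrow>
     (\<forall>\<A>. \<A> \<subseteq> \<U> \<and> \<A> \<noteq> {} \<and> |\<A>| <o \<kappa> \<longrightarrow> \<Inter>\<A> \<in> \<U>)"

definition measurable_cardinal :: "'k rel \<Rightarrow> bool" where
  "measurable_cardinal \<kappa> \<longleftrightarrow>
     Card_order \<kappa> \<and> uncountable (Field \<kappa>) \<and>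
     (\<exists>\<U>. ultrafilter_on (Field \<kappa>) \<U> \<and> nonprincipal (Field \<kappa>) \<U> \<and> complete_family \<kappa> \<U>)"

definition first_measurable_cardinal :: "'k rel \<Rightarrow> bool" where
  "first_measurable_cardinal \<kappa> \<longleftrightarrow>
     measurable_cardinal \<kappa> \<and> (\<forall>\<kappa>' :: 'k rel. measurable_cardinal \<kappa>' \<longrightarrow> \<kappa> \<le>o \<kappa>')"

text \<open>It suffices to let \<open>\<kappa>\<close> range over cardinals carried by subsets of the type \<open>'a\<close> of \<open>T\<close>:
  every cardinal \<open>\<le> |T|\<close> has a copy there, and measurability depends only on the order type. So
  if \<open>'a\<close> carries a measurable cardinal, the least one there is the first measurable cardinal up
  to isomorphism; if it carries none, then \<open>|T|\<close> is below every measurable cardinal (or there are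
  none at all), and the condition holds vacuously.\<close>

definition below_first_measurable :: "'a set \<Rightarrow> bool" where
  "below_first_measurable T \<longleftrightarrow>
     (\<forall>\<kappa> :: 'a rel. first_measurable_cardinal \<kappa> \<longrightarrow> |T| <o \<kappa>)"

end

theory Submission
  imports Defs "HOL-Library.Countable_Set_Type"
begin

text \<open>
  A sequence of sets converges in a product of discrete spaces as soon as every coordinate is
  eventually constant on it. So bisequentiality at \<open>F\<close> says: whenever an ultrafilter \<open>\<U>\<close> converges
  to \<open>F\<close>, countably many members of \<open>\<U>\<close> decide all coordinates, in the sense that for each pair
  \<open>(t, u)\<close> all functions in one of these members agree on whether they map \<open>t\<close> to \<open>u\<close>
  (\<open>bisequential_at_iff_coordinates\<close>). The size of \<open>T\<close> is below the first measurable cardinal iff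
  no nonprincipal ultrafilter on \<open>T\<close> is countably complete (\<open>below_first_measurable_iff\<close>).

  Sufficiency. If \<open>T\<close> is below the first measurable cardinal, membership in the sets of a disjoint
  family indexed by \<open>T\<close> is decided by countably many members of \<open>\<U>\<close>
  (\<open>countably_many_decide_disjoint_family\<close>). For fixed \<open>p\<close>, the functions with value \<open>u\<close> at \<open>p\<close>
  form such a family as \<open>u\<close> varies, so all pairs \<open>(p, u)\<close> can be handled for countably many \<open>p\<close>. Let
  \<open>P\<close> consist of the points \<open>p\<close> such that almost every function has a point \<open>\<ge> p\<close> in its domain.
  Domains are chains, so \<open>P\<close> is a chain, hence countable. The domain of a function meets the
  cone above at most one minimal element of \<open>T - P\<close>. So these cones give another disjoint
  family, and none of its members is in \<open>\<U>\<close>: it handles all pairs \<open>(t, u)\<close> with \<open>t \<notin> P\<close> at once.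

  Necessity. A countably complete nonprincipal ultrafilter on \<open>T\<close>, carried by the one-point
  functions \<open>t \<mapsto> t\<close>, converges to the empty function although any countably many of its members
  have a common element. An uncountable branch contains a copy \<open>H\<close> of \<open>\<omega>\<^sub>1\<close>. Call a set of pairs large
  if it has uncountably many uncountable sections over \<open>H\<close>. Some strictly decreasing function
  passes through any given finitely many large sets and avoids any given finitely many pairs
  (\<open>decreasing_function_through_large_sets\<close>), so some ultrafilter converges to the empty function
  while almost every function meets any given large set. If countably many of its members decided
  all pairs, the pairs avoided throughout one of them would form a large set, which is absurd.
\<close>

section \<open>Ultrafilters\<close>

lemma ultrafilter_onD:
  assumes "ultrafilter_on S \<U>"
  shows ultrafilter_on_subset: "A \<in> \<U> \<Longrightarrow> A \<subseteq> S"
    and ultrafilter_on_space: "S \<in> \<U>"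
    and ultrafilter_on_nonempty: "A \<in> \<U> \<Longrightarrow> A \<noteq> {}"
    and ultrafilter_on_Int: "A \<in> \<U> \<Longrightarrow> B \<in> \<U> \<Longrightarrow> A \<inter> B \<in> \<U>"
    and ultrafilter_on_mono: "A \<in> \<U> \<Longrightarrow> A \<subseteq> B \<Longrightarrow> B \<subseteq> S \<Longrightarrow> B \<in> \<U>"
    and ultrafilter_on_cases: "A \<subseteq> S \<Longrightarrow> A \<in> \<U> \<or> S - A \<in> \<U>"
    and ultrafilter_on_Diff_iff: "A \<subseteq> S \<Longrightarrow> S - A \<in> \<U> \<longleftrightarrow> A \<notin> \<U>"
proof -
  note U = assms[unfolded ultrafilter_on_def]
  show "A \<in> \<U> \<Longrightarrow> A \<subseteq> S" using U by blast
  show "S \<in> \<U>" using U by blast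
  show "A \<in> \<U> \<Longrightarrow> A \<noteq> {}" using U by blast
  show Int: "A \<in> \<U> \<Longrightarrow> B \<in> \<U> \<Longrightarrow> A \<inter> B \<in> \<U>" for A B using U by blast
  show "A \<in> \<U> \<Longrightarrow> A \<subseteq> B \<Longrightarrow> B \<subseteq> S \<Longrightarrow> B \<in> \<U>" using U by blast
  show cases: "A \<subseteq> S \<Longrightarrow> A \<in> \<U> \<or> S - A \<in> \<U>" using U by blast
  show "A \<subseteq> S \<Longrightarrow> S - A \<in> \<U> \<longleftrightarrow> A \<notin> \<U>"
    using cases Int[of A "S - A"] \<open>A \<in> \<U> \<Longrightarrow> A \<noteq> {}\<close> U by (metis Diff_disjoint)
qed

lemma ultrafilter_on_INT_atMost:
  fixes A :: "nat \<Rightarrow> 'a set"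
  assumes "ultrafilter_on S \<U>" "\<And>n. A n \<in> \<U>"
  shows "(\<Inter>i\<le>n. A i) \<in> \<U>"
proof (induction n)
  case 0
  then show ?case using assms by simp
next
  case (Suc n)
  have "(\<Inter>i\<le>Suc n. A i) = A (Suc n) \<inter> (\<Inter>i\<le>n. A i)"
    by (auto simp: le_Suc_eq)
  then show ?case using Suc assms ultrafilter_on_Int by metis
qed

text \<open>Zorn's lemma: among the families with the finite intersection property a maximal one
  decides every subset of \<open>X\<close>.\<close>

lemma ultrafilter_extension:
  assumes sub: "\<S> \<subseteq> Pow X"
    and fip: "\<And>\<F>. finite \<F> \<Longrightarrow> \<F> \<subseteq> \<S> \<Longrightarrow> X \<inter> \<Inter>\<F> \<noteq> {}"
  obtains \<U> where "ultrafilter_on X \<U>" "\<S> \<subseteq> \<U>"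
proof -
  define Q where "Q = {\<M>. \<S> \<subseteq> \<M> \<and> \<M> \<subseteq> Pow X \<and> (\<forall>\<F>. finite \<F> \<and> \<F> \<subseteq> \<M> \<longrightarrow> X \<inter> \<Inter>\<F> \<noteq> {})}"
  have "\<exists>M\<in>Q. \<forall>N\<in>Q. M \<subseteq> N \<longrightarrow> N = M"
  proof (rule subset_Zorn_nonempty)
    have "\<S> \<in> Q" unfolding Q_def using sub fip by (intro CollectI conjI allI impI subset_refl) simp_all
    then show "Q \<noteq> {}" by blast
  next
    fix \<C> assume ne: "\<C> \<noteq> {}" and ch: "subset.chain Q \<C>"
    have CQ: "\<C> \<subseteq> Q" using ch by (simp add: subset_chain_def)
    have "X \<inter> \<Inter>\<F> \<noteq> {}" if F: "finite \<F>" "\<F> \<subseteq> \<Union>\<C>" for \<F>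
    proof -
      obtain M where "M \<in> \<C>" "\<F> \<subseteq> M"
        using finite_subset_Union_chain[OF F ne ch] .
      then show ?thesis using CQ F(1) by (auto simp: Q_def)
    qed
    moreover have "\<S> \<subseteq> M \<and> M \<subseteq> Pow X" if "M \<in> \<C>" for M
      using subsetD[OF CQ that] by (simp add: Q_def)
    then have "\<S> \<subseteq> \<Union>\<C>" "\<Union>\<C> \<subseteq> Pow X" using ne by blast+
    ultimately show "\<Union>\<C> \<in> Q" unfolding Q_def by simp
  qed
  then obtain M where MQ: "M \<in> Q" and max: "\<And>N. N \<in> Q \<Longrightarrow> M \<subseteq> N \<Longrightarrow> N = M"
    by blast
  have Mfip: "X \<inter> \<Inter>\<F> \<noteq> {}" if "finite \<F>" "\<F> \<subseteq> M" for \<F>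
    using MQ that by (auto simp: Q_def)
  have notin: "\<exists>\<F>. finite \<F> \<and> \<F> \<subseteq> M \<and> X \<inter> \<Inter>\<F> \<inter> A = {}" if "A \<subseteq> X" "A \<notin> M" for A
  proof (rule ccontr)
    assume no: "\<not> ?thesis"
    have "insert A M \<in> Q"
      unfolding Q_def
    proof (intro CollectI conjI allI impI)
      show "\<S> \<subseteq> insert A M" "insert A M \<subseteq> Pow X"
        using MQ that by (auto simp: Q_def)
      fix \<F> assume F: "finite \<F> \<and> \<F> \<subseteq> insert A M"
      then have "X \<inter> \<Inter>(\<F> - {A}) \<inter> A \<noteq> {}"
        using no by (metis Diff_subset_conv finite_Diff insert_is_Un)
      then show "X \<inter> \<Inter>\<F> \<noteq> {}" by blast
    qed
    then show False using max that(2) by blast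
  qed
  have cases: "A \<in> M \<or> X - A \<in> M" if A: "A \<subseteq> X" for A
  proof (rule ccontr)
    assume "\<not> ?thesis"
    then obtain \<F> \<G> where "finite \<F>" "\<F> \<subseteq> M" "X \<inter> \<Inter>\<F> \<inter> A = {}"
      and "finite \<G>" "\<G> \<subseteq> M" "X \<inter> \<Inter>\<G> \<inter> (X - A) = {}"
      using notin[of A] notin[of "X - A"] A by blast
    moreover from this have "X \<inter> \<Inter>(\<F> \<union> \<G>) = {}" by blast
    ultimately show False using Mfip[of "\<F> \<union> \<G>"] by simp
  qed
  have up: "B \<in> M" if "A \<in> M" "A' \<in> M" "A \<inter> A' \<subseteq> B" "B \<subseteq> X" for A A' B
    using cases[OF that(4)] Mfip[of "{A, A', X - B}"] that by auto
  have "ultrafilter_on X M"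
    unfolding ultrafilter_on_def
  proof (intro conjI ballI allI impI)
    show "M \<subseteq> Pow X" using MQ by (auto simp: Q_def)
    show "{} \<notin> M" using Mfip[of "{{}}"] by auto
    then show "X \<in> M" using cases[of X] by simp
    show "A \<inter> B \<in> M" if "A \<in> M" "B \<in> M" for A B
      using up[OF that, of "A \<inter> B"] that \<open>M \<subseteq> Pow X\<close> by blast
    show "B \<in> M" if "A \<in> M" "A \<subseteq> B \<and> B \<subseteq> X" for A B
      using up[OF that(1) that(1)] that by blast
    show "A \<in> M \<or> X - A \<in> M" if "A \<subseteq> X" for A using cases that .
  qed
  moreover have "\<S> \<subseteq> M" using MQ by (simp add: Q_def)
  ultimately show ?thesis by (rule that)
qed

text \<open>The induced family is the image of \<open>\<U>\<close> under the map that sends a point to the index of its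
  block; this map is defined on a member of \<open>\<U>\<close>.\<close>

lemma ultrafilter_on_quotient:
  assumes U: "ultrafilter_on X \<U>" and disj: "disjoint_family_on E T"
    and union: "(\<Union>t\<in>T. E t) \<in> \<U>"
  shows "ultrafilter_on T {B. B \<subseteq> T \<and> (\<Union>t\<in>B. E t) \<in> \<U>}"
proof -
  have EX: "E t \<subseteq> X" if "t \<in> T" for t
    using ultrafilter_on_subset[OF U union] that by blast
  have Int: "(\<Union>t\<in>A. E t) \<inter> (\<Union>t\<in>B. E t) = (\<Union>t\<in>A \<inter> B. E t)" if "A \<subseteq> T" "B \<subseteq> T" for A B
  proof
    show "(\<Union>t\<in>A. E t) \<inter> (\<Union>t\<in>B. E t) \<subseteq> (\<Union>t\<in>A \<inter> B. E t)"
    proof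
      fix x assume "x \<in> (\<Union>t\<in>A. E t) \<inter> (\<Union>t\<in>B. E t)"
      then obtain s t where st: "s \<in> A" "x \<in> E s" "t \<in> B" "x \<in> E t" by blast
      then have "s = t" using disj that unfolding disjoint_family_on_def by (metis disjoint_iff subsetD)
      then show "x \<in> (\<Union>t\<in>A \<inter> B. E t)" using st by blast
    qed
  qed blast
  have cases: "(\<Union>t\<in>A. E t) \<in> \<U> \<or> (\<Union>t\<in>T - A. E t) \<in> \<U>" if A: "A \<subseteq> T" for A
  proof (cases "(\<Union>t\<in>A. E t) \<in> \<U>")
    case False
    then have "X - (\<Union>t\<in>A. E t) \<in> \<U>"
      using ultrafilter_on_cases[OF U, of "\<Union>t\<in>A. E t"] EX A by blast
    from ultrafilter_on_Int[OF U this union] show ?thesis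
      using ultrafilter_on_mono[OF U, of _ "\<Union>t\<in>T - A. E t"] EX by blast
  qed simp
  show ?thesis
    unfolding ultrafilter_on_def
  proof (intro conjI ballI allI impI)
    show "{} \<notin> {B. B \<subseteq> T \<and> (\<Union>t\<in>B. E t) \<in> \<U>}"
      using ultrafilter_on_nonempty[OF U] by auto
    show "A \<inter> B \<in> {B. B \<subseteq> T \<and> (\<Union>t\<in>B. E t) \<in> \<U>}"
      if "A \<in> {B. B \<subseteq> T \<and> (\<Union>t\<in>B. E t) \<in> \<U>}" "B \<in> {B. B \<subseteq> T \<and> (\<Union>t\<in>B. E t) \<in> \<U>}" for A B
      using ultrafilter_on_Int[OF U, of "\<Union>t\<in>A. E t" "\<Union>t\<in>B. E t"] Int[of A B] that by auto
    show "B \<in> {B. B \<subseteq> T \<and> (\<Union>t\<in>B. E t) \<in> \<U>}"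
      if "A \<in> {B. B \<subseteq> T \<and> (\<Union>t\<in>B. E t) \<in> \<U>}" "A \<subseteq> B \<and> B \<subseteq> T" for A B
      using ultrafilter_on_mono[OF U, of "\<Union>t\<in>A. E t" "\<Union>t\<in>B. E t"] EX that by blast
  qed (use union cases in auto)
qed

lemma ultrafilter_on_image:
  assumes U: "ultrafilter_on X \<U>" and g: "g ` X \<subseteq> K"
  shows "ultrafilter_on K {B. B \<subseteq> K \<and> {x \<in> X. g x \<in> B} \<in> \<U>}"
proof -
  have eq: "(\<Union>k\<in>B. {x \<in> X. g x = k}) = {x \<in> X. g x \<in> B}" for B by auto
  have K: "{x \<in> X. g x \<in> K} = X" using g by auto
  show ?thesis
    using ultrafilter_on_quotient[OF U, of "\<lambda>k. {x \<in> X. g x = k}" K] ultrafilter_on_space[OF U]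
    by (simp add: eq K disjoint_family_on_def) blast
qed

lemma principal_if_singleton:
  assumes U: "ultrafilter_on S \<U>" and a: "{a} \<in> \<U>"
  shows "\<not> nonprincipal S \<U>"
proof -
  have "a \<in> S" using ultrafilter_on_subset[OF U a] by simp
  moreover have "A \<in> \<U> \<longleftrightarrow> A \<subseteq> S \<and> a \<in> A" for A
  proof
    assume A: "A \<in> \<U>"
    then have "A \<inter> {a} \<noteq> {}"
      using ultrafilter_on_nonempty[OF U] ultrafilter_on_Int[OF U A a] by blast
    then show "A \<subseteq> S \<and> a \<in> A" using ultrafilter_on_subset[OF U A] by blast
  next
    assume "A \<subseteq> S \<and> a \<in> A"
    then show "A \<in> \<U>" using ultrafilter_on_mono[OF U a] by blast
  qed
  ultimately show ?thesis unfolding nonprincipal_def by blast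
qed

lemma nonprincipal_iff:
  assumes U: "ultrafilter_on S \<U>"
  shows "nonprincipal S \<U> \<longleftrightarrow> (\<forall>a. {a} \<notin> \<U>)"
  using principal_if_singleton[OF U] unfolding nonprincipal_def by blast

section \<open>Countably complete ultrafilters and measurable cardinals\<close>

definition countably_complete :: "'a set set \<Rightarrow> bool" where
  "countably_complete \<U> \<longleftrightarrow> (\<forall>A :: nat \<Rightarrow> 'a set. (\<forall>n. A n \<in> \<U>) \<longrightarrow> (\<Inter>n. A n) \<in> \<U>)"

lemma countably_complete_image:
  assumes "countably_complete \<U>"
  shows "countably_complete {B. B \<subseteq> K \<and> {x \<in> X. g x \<in> B} \<in> \<U>}"
  unfolding countably_complete_def
proof (intro allI impI)
  fix A :: "nat \<Rightarrow> _" assume A: "\<forall>n. A n \<in> {B. B \<subseteq> K \<and> {x \<in> X. g x \<in> B} \<in> \<U>}"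
  then have "(\<Inter>n. {x \<in> X. g x \<in> A n}) \<in> \<U>"
    using assms by (auto simp: countably_complete_def)
  moreover have "(\<Inter>n. {x \<in> X. g x \<in> A n}) = {x \<in> X. g x \<in> (\<Inter>n. A n)}" by auto
  moreover have "(\<Inter>n. A n) \<subseteq> K" using A by blast
  ultimately show "(\<Inter>n. A n) \<in> {B. B \<subseteq> K \<and> {x \<in> X. g x \<in> B} \<in> \<U>}" by simp
qed

lemma Inter_countable_family:
  assumes cc: "countably_complete \<U>" and K: "countable K" "K \<noteq> {}" and A: "\<And>k. k \<in> K \<Longrightarrow> A k \<in> \<U>"
  shows "(\<Inter>k\<in>K. A k) \<in> \<U>"
proof -
  have "(\<Inter>n. A (from_nat_into K n)) \<in> \<U>"
    using cc A from_nat_into[OF K(2)] by (auto simp: countably_complete_def)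
  moreover have "(\<Inter>n. A (from_nat_into K n)) = (\<Inter>k\<in>K. A k)"
    using range_from_nat_into[OF K(2,1)] by (metis image_image)
  ultimately show ?thesis by simp
qed

lemma measurable_cardinal_countably_complete:
  assumes "measurable_cardinal \<kappa>"
  obtains \<U> where "ultrafilter_on (Field \<kappa>) \<U>" "nonprincipal (Field \<kappa>) \<U>" "countably_complete \<U>"
proof -
  obtain \<U> where U: "ultrafilter_on (Field \<kappa>) \<U>" "nonprincipal (Field \<kappa>) \<U>"
    and cf: "complete_family \<kappa> \<U>" and card: "Card_order \<kappa>" and unc: "uncountable (Field \<kappa>)"
    using assms unfolding measurable_cardinal_def by metis
  have small: "|C| <o \<kappa>" if "countable C" for C :: "'a set set"
  proof -
    have "\<not> |Field \<kappa>| \<le>o |C|"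
      using that unc countable_card_of_nat ordLeq_transitive by metis
    then have "|C| <o |Field \<kappa>|"
      using not_ordLeq_iff_ordLess[OF card_of_Well_order card_of_Well_order] by blast
    then show ?thesis using card_of_Field_ordIso[OF card] ordLess_ordIso_trans by blast
  qed
  have "countably_complete \<U>"
    unfolding countably_complete_def
  proof (intro allI impI)
    fix A :: "nat \<Rightarrow> _" assume "\<forall>n. A n \<in> \<U>"
    then have "range A \<subseteq> \<U>" by blast
    moreover have "|range A| <o \<kappa>" by (rule small) simp
    ultimately show "(\<Inter>n. A n) \<in> \<U>"
      using cf unfolding complete_family_def by (metis empty_iff rangeI)
  qed
  then show ?thesis using that U by metis
qed

text \<open>Take \<open>K\<close> of least cardinality among the sets that index a family of members of \<open>\<U>\<close> whose
  intersection is not in \<open>\<U>\<close>. Almost every point \<open>x\<close> is missed by some member of this family;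
  sending \<open>x\<close> to an index of such a member maps \<open>\<U>\<close> to an ultrafilter on \<open>K\<close>. It is nonprincipal
  because the fibre of \<open>k\<close> is almost disjoint from the member with index \<open>k\<close>, and \<open>|K|\<close>-complete
  by the minimality of \<open>K\<close>.\<close>

lemma measurable_cardinal_le:
  fixes S :: "'a set"
  assumes U: "ultrafilter_on S \<U>" and np: "nonprincipal S \<U>" and cc: "countably_complete \<U>"
  obtains \<kappa> :: "'a rel" where "measurable_cardinal \<kappa>" "\<kappa> \<le>o |S|"
proof -
  define bad where "bad K \<longleftrightarrow> K \<noteq> {} \<and> (\<exists>A. (\<forall>k\<in>K. A k \<in> \<U>) \<and> (\<Inter>k\<in>K. A k) \<notin> \<U>)" for K :: "'a set"
  \<comment> \<open>The complements of the points show that \<open>S\<close> itself is an index set of this kind.\<close>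
  have sing: "{a} \<notin> \<U>" for a using np nonprincipal_iff[OF U] by blast
  have "S - {s} \<in> \<U>" if "s \<in> S" for s
    using ultrafilter_on_Diff_iff[OF U, of "{s}"] sing that by auto
  moreover have "S \<noteq> {}" using ultrafilter_on_space[OF U] ultrafilter_on_nonempty[OF U] by blast
  moreover have "(\<Inter>s\<in>S. S - {s}) = {}" using \<open>S \<noteq> {}\<close> by blast
  moreover have "{} \<notin> \<U>" using ultrafilter_on_nonempty[OF U] by blast
  ultimately have badS: "bad S" unfolding bad_def by (metis (no_types, lifting))
  have "\<exists>r \<in> (\<lambda>K. |K| ) ` {K. bad K}. \<forall>r' \<in> (\<lambda>K. |K| ) ` {K. bad K}. r \<le>o r'"
    using badS card_of_Card_order by (intro exists_minim_Card_order) blast+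
  then obtain K where badK: "bad K" and min: "\<And>K'. bad K' \<Longrightarrow> |K| \<le>o |K'|"
    by blast
  obtain A where A: "\<And>k. k \<in> K \<Longrightarrow> A k \<in> \<U>" and AI: "(\<Inter>k\<in>K. A k) \<notin> \<U>" and Kne: "K \<noteq> {}"
    using badK unfolding bad_def by blast
  define I where "I = S \<inter> (\<Inter>k\<in>K. A k)"
  have IA: "I = (\<Inter>k\<in>K. A k)" using A Kne ultrafilter_on_subset[OF U] unfolding I_def by blast
  define g where "g x = (if x \<in> I then (SOME k. k \<in> K) else (SOME k. k \<in> K \<and> x \<notin> A k))" for x
  have g_in: "g x \<in> K" if "x \<in> S" for x
    using that Kne someI_ex[of "\<lambda>k. k \<in> K \<and> x \<notin> A k"] someI_ex[of "\<lambda>k. k \<in> K"]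
    unfolding g_def I_def by auto
  have g_out: "x \<notin> A (g x)" if "x \<in> S" "x \<notin> I" for x
    using that someI_ex[of "\<lambda>k. k \<in> K \<and> x \<notin> A k"] unfolding g_def I_def by auto
  define \<V> where "\<V> = {B. B \<subseteq> K \<and> {x \<in> S. g x \<in> B} \<in> \<U>}"
  have V: "ultrafilter_on K \<V>"
    unfolding \<V>_def using g_in by (intro ultrafilter_on_image[OF U]) auto
  have Iout: "S - I \<in> \<U>" using ultrafilter_on_Diff_iff[OF U, of I] AI IA by (auto simp: I_def)
  have "nonprincipal K \<V>"
    unfolding nonprincipal_iff[OF V]
  proof
    fix k show "{k} \<notin> \<V>"
    proof
      assume "{k} \<in> \<V>"
      then have k: "k \<in> K" "{x \<in> S. g x = k} \<in> \<U>" unfolding \<V>_def by auto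
      have "{x \<in> S. g x = k} \<inter> ((S - I) \<inter> A k) \<in> \<U>"
        using ultrafilter_on_Int[OF U] k A Iout by blast
      moreover have "{x \<in> S. g x = k} \<inter> ((S - I) \<inter> A k) = {}" using g_out by auto
      ultimately show False using ultrafilter_on_nonempty[OF U] by metis
    qed
  qed
  moreover have "complete_family |K| \<V>"
    unfolding complete_family_def
  proof (intro allI impI)
    fix \<B> assume B: "\<B> \<subseteq> \<V> \<and> \<B> \<noteq> {} \<and> |\<B>| <o |K|"
    \<comment> \<open>Minimality concerns index sets within the type \<open>'a\<close>, so \<open>\<B>\<close> is reindexed by a subset of \<open>K\<close>.\<close>
    then obtain h where h: "inj_on h \<B>" "h ` \<B> \<subseteq> K"
      using card_of_ordLeq[of \<B> K] ordLess_imp_ordLeq by blast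
    have hB: "|h ` \<B>| =o |\<B>|"
      using h(1) card_of_ordIso by (metis bij_betw_def ordIso_symmetric)
    then have "\<not> bad (h ` \<B>)"
      using min[of "h ` \<B>"] B by (meson not_ordLess_ordLeq ordIso_ordLess_trans)
    moreover have "h ` \<B> \<noteq> {}" using B by simp
    moreover have "\<forall>k\<in>h ` \<B>. {x \<in> S. g x \<in> inv_into \<B> h k} \<in> \<U>"
      using B h(1) by (auto simp: \<V>_def)
    ultimately have "(\<Inter>k\<in>h ` \<B>. {x \<in> S. g x \<in> inv_into \<B> h k}) \<in> \<U>"
      unfolding bad_def by (metis (mono_tags, lifting))
    moreover have "(\<Inter>k\<in>h ` \<B>. {x \<in> S. g x \<in> inv_into \<B> h k}) = {x \<in> S. g x \<in> \<Inter>\<B>}"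
      using B h(1) by auto
    moreover have "\<Inter>\<B> \<subseteq> K" using B unfolding \<V>_def by blast
    ultimately show "\<Inter>\<B> \<in> \<V>" unfolding \<V>_def by simp
  qed
  moreover have "uncountable K"
  proof
    assume "countable K"
    from Inter_countable_family[OF cc this Kne, of A] A AI show False by simp
  qed
  ultimately have "measurable_cardinal |K|"
    unfolding measurable_cardinal_def Field_card_of using V by (auto simp: card_of_card_order_on)
  then show ?thesis using that min[OF badS] by metis
qed

text \<open>An injection of the first measurable cardinal into \<open>T\<close> transports its ultrafilter to \<open>T\<close>.
  Conversely a countably complete nonprincipal ultrafilter on \<open>T\<close> produces a measurable cardinal
  of size at most \<open>|T|\<close>.\<close>

lemma below_first_measurable_iff:
  fixes T :: "'a set"
  shows "below_first_measurable T \<longleftrightarrow>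
    \<not> (\<exists>\<U>. ultrafilter_on T \<U> \<and> nonprincipal T \<U> \<and> countably_complete \<U>)" (is "_ \<longleftrightarrow> \<not> ?M")
proof
  assume below: "below_first_measurable T"
  show "\<not> ?M"
  proof
    assume ?M
    then obtain \<kappa> :: "'a rel" where \<kappa>: "measurable_cardinal \<kappa>" "\<kappa> \<le>o |T|"
      by (metis measurable_cardinal_le)
    have "{r :: 'a rel. measurable_cardinal r} \<noteq> {}" using \<kappa>(1) by blast
    moreover have "\<forall>r \<in> {r :: 'a rel. measurable_cardinal r}. Card_order r"
      by (simp add: measurable_cardinal_def)
    ultimately have "\<exists>r \<in> {r :: 'a rel. measurable_cardinal r}. \<forall>r' \<in> {r :: 'a rel. measurable_cardinal r}. r \<le>o r'"
      by (rule exists_minim_Card_order)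
    then obtain r :: "'a rel" where r: "first_measurable_cardinal r"
      unfolding first_measurable_cardinal_def by blast
    then have "r \<le>o |T|"
      using \<kappa> ordLeq_transitive unfolding first_measurable_cardinal_def by blast
    moreover have "|T| <o r" using below r unfolding below_first_measurable_def by blast
    ultimately show False using not_ordLess_ordLeq by blast
  qed
next
  assume no: "\<not> ?M"
  show "below_first_measurable T"
    unfolding below_first_measurable_def
  proof (intro allI impI, rule ccontr)
    fix \<kappa> :: "'a rel" assume first: "first_measurable_cardinal \<kappa>" and "\<not> |T| <o \<kappa>"
    then have meas: "measurable_cardinal \<kappa>" and card: "Card_order \<kappa>"
      unfolding first_measurable_cardinal_def measurable_cardinal_def by blast+
    have "\<kappa> \<le>o |T|"
      using \<open>\<not> |T| <o \<kappa>\<close> card not_ordLess_iff_ordLeq[OF card_order_on_well_order_on[OF card] card_of_Well_order] by blast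
    then have "|Field \<kappa>| \<le>o |T|"
      using card_of_Field_ordIso[OF card] ordIso_ordLeq_trans by blast
    then obtain h where h: "inj_on h (Field \<kappa>)" "h ` Field \<kappa> \<subseteq> T"
      using card_of_ordLeq by metis
    obtain \<U> where U: "ultrafilter_on (Field \<kappa>) \<U>" "nonprincipal (Field \<kappa>) \<U>" "countably_complete \<U>"
      using measurable_cardinal_countably_complete[OF meas] .
    let ?V = "{B. B \<subseteq> T \<and> {x \<in> Field \<kappa>. h x \<in> B} \<in> \<U>}"
    have V: "ultrafilter_on T ?V" using ultrafilter_on_image[OF U(1) h(2)] .
    have fibre: "{x \<in> Field \<kappa>. h x = t} \<notin> \<U>" for t
    proof
      assume F: "{x \<in> Field \<kappa>. h x = t} \<in> \<U>"
      then obtain x where x: "x \<in> Field \<kappa>" "h x = t" using ultrafilter_on_nonempty[OF U(1)] by blast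
      then have "{y \<in> Field \<kappa>. h y = t} = {x}" using h(1) by (auto dest: inj_onD)
      then show False using F U(2) nonprincipal_iff[OF U(1)] by auto
    qed
    then have "nonprincipal T ?V" unfolding nonprincipal_iff[OF V] by simp
    with V no countably_complete_image[OF U(3)] show False by blast
  qed
qed

text \<open>This is how the size of \<open>T\<close> enters: countably many members of \<open>\<U>\<close> decide membership in
  every block of a disjoint family indexed by \<open>T\<close>. If the induced ultrafilter on the indices is
  principal, one member suffices; otherwise it is not countably complete, and a sequence of
  members with too small an intersection \<open>D\<close> separates \<open>\<U>\<close> from the blocks with index outside
  \<open>D\<close>, while the complement of the union over \<open>D\<close> takes care of the remaining ones.\<close>

lemma countably_many_decide_disjoint_family:
  assumes below: "below_first_measurable T"
    and U: "ultrafilter_on X \<U>" and disj: "disjoint_family_on E T"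
    and EX: "\<And>t. t \<in> T \<Longrightarrow> E t \<subseteq> X"
  shows "\<exists>\<C>. countable \<C> \<and> \<C> \<subseteq> \<U> \<and> (\<forall>t\<in>T. \<exists>A\<in>\<C>. A \<subseteq> E t \<or> A \<inter> E t = {})"
proof (cases "(\<Union>t\<in>T. E t) \<in> \<U>")
  case False
  then have "X - (\<Union>t\<in>T. E t) \<in> \<U>"
    using ultrafilter_on_cases[OF U, of "\<Union>t\<in>T. E t"] EX by blast
  then show ?thesis by (intro exI[of _ "{X - (\<Union>t\<in>T. E t)}"]) auto
next
  case union: True
  let ?V = "{B. B \<subseteq> T \<and> (\<Union>t\<in>B. E t) \<in> \<U>}"
  have V: "ultrafilter_on T ?V" using ultrafilter_on_quotient[OF U disj union] .
  show ?thesis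
  proof (cases "nonprincipal T ?V")
    case False
    then obtain s where s: "s \<in> T" "E s \<in> \<U>" using nonprincipal_iff[OF V] by auto
    have "E s \<subseteq> E t \<or> E s \<inter> E t = {}" if "t \<in> T" for t
      using disj s(1) that unfolding disjoint_family_on_def by (metis order_refl)
    then show ?thesis using s(2) by (intro exI[of _ "{E s}"]) simp
  next
    case True
    then obtain B where B: "\<And>n::nat. B n \<in> ?V" and BI: "(\<Inter>n. B n) \<notin> ?V"
      using below V unfolding below_first_measurable_iff countably_complete_def by blast
    define D where "D = (\<Inter>n. B n)"
    have D: "D \<subseteq> T" using B by (auto simp: D_def)
    have "T - D \<in> ?V" using ultrafilter_on_cases[OF V D] BI by (auto simp: D_def)
    then have TD: "(\<Union>t\<in>T - D. E t) \<in> \<U>" by blast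
    have miss: "(\<Union>u\<in>C. E u) \<inter> E t = {}" if "C \<subseteq> T" "t \<in> T" "t \<notin> C" for C t
    proof -
      have "E u \<inter> E t = {}" if "u \<in> C" for u
        using disj \<open>C \<subseteq> T\<close> \<open>t \<in> T\<close> \<open>t \<notin> C\<close> that unfolding disjoint_family_on_def by (metis subsetD)
      then show ?thesis by blast
    qed
    let ?C = "insert (\<Union>t\<in>T - D. E t) (range (\<lambda>n. \<Union>t\<in>B n. E t))"
    have "\<exists>A\<in>?C. A \<inter> E t = {}" if t: "t \<in> T" for t
    proof (cases "t \<in> D")
      case True
      then show ?thesis using miss[of "T - D" t] t by blast
    next
      case False
      then obtain n where "t \<notin> B n" by (auto simp: D_def)
      then show ?thesis using miss[of "B n" t] t B by blast
    qed
    moreover have "?C \<subseteq> \<U>" using TD B by blast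
    moreover have "countable ?C" by simp
    ultimately show ?thesis by (intro exI[of _ ?C] conjI ballI) (assumption, assumption, metis)
  qed
qed

section \<open>Bisequentiality in products of discrete spaces\<close>

context
  fixes D :: "'b set" and I :: "'i set" and S :: "('i \<Rightarrow> 'b) set" and Y :: "('i \<Rightarrow> 'b) topology"
  assumes S: "S \<subseteq> (\<Pi>\<^sub>E i\<in>I. D)"
    and Y: "Y = subtopology (product_topology (\<lambda>_. discrete_topology D) I) S"
begin

lemma topspace_discrete_product: "topspace Y = S"
  using S by (auto simp: Y)

lemma neighborhood_coordinate:
  assumes x: "x \<in> S" and i: "i \<in> I"
  shows "neighborhood Y x {y \<in> S. y i = x i}"
proof -
  have xi: "x i \<in> D" using S x i by auto
  have "openin (product_topology (\<lambda>_. discrete_topology D) I)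
      {y \<in> topspace (product_topology (\<lambda>_. discrete_topology D) I). y i \<in> {x i}}"
    using xi by (intro openin_continuous_map_preimage[OF continuous_map_product_projection[OF i]]) simp
  moreover have "S \<inter> {y \<in> topspace (product_topology (\<lambda>_. discrete_topology D) I). y i \<in> {x i}}
      = {y \<in> S. y i = x i}"
    using S by auto
  ultimately have "openin Y {y \<in> S. y i = x i}"
    unfolding Y openin_subtopology by (metis (no_types) inf_commute)
  then show ?thesis
    unfolding neighborhood_def topspace_discrete_product using x by blast
qed

lemma neighborhood_contains_cylinder:
  assumes "neighborhood Y x N" and x: "x \<in> S"
  obtains Q where "finite Q" "Q \<subseteq> I" "{y \<in> S. \<forall>i\<in>Q. y i = x i} \<subseteq> N"
proof -
  obtain V where V: "openin Y V" "x \<in> V" "V \<subseteq> N"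
    using assms unfolding neighborhood_def by blast
  then obtain V' where V': "openin (product_topology (\<lambda>_. discrete_topology D) I) V'" "V = V' \<inter> S"
    unfolding Y openin_subtopology by blast
  then obtain W where W: "finite {i \<in> I. W i \<noteq> D}" "x \<in> Pi\<^sub>E I W" "Pi\<^sub>E I W \<subseteq> V'"
    using V(2) unfolding openin_product_topology_alt by (auto; metis)
  let ?Q = "{i \<in> I. W i \<noteq> D}"
  have "y \<in> Pi\<^sub>E I W" if y: "y \<in> S" "\<forall>i\<in>?Q. y i = x i" for y
  proof (rule PiE_I)
    fix i assume "i \<in> I"
    then show "y i \<in> W i" using S W(2) y by (cases "W i = D") auto
  qed (use S y in auto)
  then have "{y \<in> S. \<forall>i\<in>?Q. y i = x i} \<subseteq> N" using W(3) V V' by blast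
  then show ?thesis using that[of ?Q] W(1) by simp
qed

lemma ultrafilter_converges_iff_coordinates:
  assumes U: "ultrafilter_on S \<U>" and x: "x \<in> S"
  shows "ultrafilter_converges Y \<U> x \<longleftrightarrow> (\<forall>i\<in>I. {y \<in> S. y i = x i} \<in> \<U>)"
proof
  assume "ultrafilter_converges Y \<U> x"
  then show "\<forall>i\<in>I. {y \<in> S. y i = x i} \<in> \<U>"
    using neighborhood_coordinate[OF x] unfolding ultrafilter_converges_def by blast
next
  assume R: "\<forall>i\<in>I. {y \<in> S. y i = x i} \<in> \<U>"
  have cyl: "{y \<in> S. \<forall>i\<in>Q. y i = x i} \<in> \<U>" if "finite Q" "Q \<subseteq> I" for Q
    using that
  proof (induction Q)
    case empty
    then show ?case using ultrafilter_on_space[OF U] by simp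
  next
    case (insert j Q)
    then have "{y \<in> S. y j = x j} \<inter> {y \<in> S. \<forall>i\<in>Q. y i = x i} \<in> \<U>"
      using R ultrafilter_on_Int[OF U] by blast
    moreover have "{y \<in> S. y j = x j} \<inter> {y \<in> S. \<forall>i\<in>Q. y i = x i}
      = {y \<in> S. \<forall>i\<in>insert j Q. y i = x i}" by blast
    ultimately show ?case by simp
  qed
  show "ultrafilter_converges Y \<U> x"
    unfolding ultrafilter_converges_def
  proof (intro allI impI)
    fix N assume N: "neighborhood Y x N"
    then obtain Q where "finite Q" "Q \<subseteq> I" "{y \<in> S. \<forall>i\<in>Q. y i = x i} \<subseteq> N"
      using neighborhood_contains_cylinder x by blast
    moreover have "N \<subseteq> S" using N by (simp add: neighborhood_def topspace_discrete_product)
    ultimately show "N \<in> \<U>" using ultrafilter_on_mono[OF U cyl] by blast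
  qed
qed

text \<open>In a product of discrete spaces a basic neighbourhood restricts finitely many coordinates.
  Hence a decreasing sequence in \<open>\<U>\<close> converges as soon as each coordinate is eventually constant
  on it, and its members may be taken as finite intersections of a countable subset of \<open>\<U>\<close>.\<close>

lemma bisequential_at_iff_coordinates:
  assumes x: "x \<in> S"
  shows "bisequential_at Y x \<longleftrightarrow>
    (\<forall>\<U>. ultrafilter_on S \<U> \<and> (\<forall>i\<in>I. {y \<in> S. y i = x i} \<in> \<U>) \<longrightarrow>
      (\<exists>\<C>. countable \<C> \<and> \<C> \<subseteq> \<U> \<and> (\<forall>i\<in>I. \<exists>A\<in>\<C>. \<forall>y\<in>A. y i = x i)))"
proof -
  have "(\<exists>V. (\<forall>n. V n \<in> \<U>) \<and> decseq V \<and> sets_converge Y V x) \<longleftrightarrow>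
      (\<exists>\<C>. countable \<C> \<and> \<C> \<subseteq> \<U> \<and> (\<forall>i\<in>I. \<exists>A\<in>\<C>. \<forall>y\<in>A. y i = x i))" (is "?L \<longleftrightarrow> ?R")
    if U: "ultrafilter_on S \<U>" for \<U>
  proof
    assume ?L
    then obtain V where V: "\<And>n. V n \<in> \<U>" "sets_converge Y V x" by blast
    have "\<exists>A\<in>range V. \<forall>y\<in>A. y i = x i" if i: "i \<in> I" for i
    proof -
      obtain n0 where "\<forall>n>n0. V n \<subseteq> {y \<in> S. y i = x i}"
        using V(2) neighborhood_coordinate[OF x i] unfolding sets_converge_def by blast
      then have "V (Suc n0) \<subseteq> {y \<in> S. y i = x i}" by blast
      then show ?thesis by blast
    qed
    moreover have "range V \<subseteq> \<U>" using V(1) by blast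
    moreover have "countable (range V)" by simp
    ultimately show ?R by (intro exI[of _ "range V"] conjI ballI)
  next
    assume ?R
    then obtain \<C> where C: "countable \<C>" "\<C> \<subseteq> \<U>" "\<And>i. i \<in> I \<Longrightarrow> \<exists>A\<in>\<C>. \<forall>y\<in>A. y i = x i"
      by (elim exE conjE) (metis (no_types))
    \<comment> \<open>Inserting \<open>S\<close> makes the family nonempty, as an enumeration requires.\<close>
    define A where "A = from_nat_into (insert S \<C>)"
    define V where "V n = (\<Inter>i\<le>n. A i)" for n :: nat
    have rA: "range A = insert S \<C>"
      unfolding A_def using C(1) by (intro range_from_nat_into) auto
    then have "A n \<in> \<U>" for n
      using C(2) ultrafilter_on_space[OF U] by (metis insert_subset rangeI subset_iff)
    then have VU: "V n \<in> \<U>" for n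
      unfolding V_def by (intro ultrafilter_on_INT_atMost[OF U])
    have dec: "V n \<subseteq> V m" if "m \<le> n" for m n using that unfolding V_def by force
    have ev: "\<exists>n. \<forall>y\<in>V n. y i = x i" if i: "i \<in> I" for i
    proof -
      obtain B n where "\<forall>y\<in>B. y i = x i" "B = A n"
        using C(3)[OF i] rA by (metis imageE insertCI)
      then show ?thesis by (auto simp: V_def)
    qed
    have ev_fin: "\<exists>n. \<forall>y\<in>V n. \<forall>i\<in>Q. y i = x i" if "finite Q" "Q \<subseteq> I" for Q
      using that
    proof (induction Q)
      case (insert j Q)
      then obtain n where "\<forall>y\<in>V n. \<forall>i\<in>Q. y i = x i" by auto
      moreover obtain m where "\<forall>y\<in>V m. y j = x j" using ev[of j] insert.prems by auto
      ultimately have "\<forall>y\<in>V (max n m). \<forall>i\<in>insert j Q. y i = x i"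
        using dec[of n "max n m"] dec[of m "max n m"] by auto
      then show ?case by blast
    qed auto
    have "sets_converge Y V x"
      unfolding sets_converge_def topspace_discrete_product
    proof (intro conjI allI impI)
      show "V n \<noteq> {}" "V n \<subseteq> S" for n
        using VU ultrafilter_on_nonempty[OF U] ultrafilter_on_subset[OF U] by blast+
      fix N assume "neighborhood Y x N"
      then obtain Q where Q: "finite Q" "Q \<subseteq> I" "{y \<in> S. \<forall>i\<in>Q. y i = x i} \<subseteq> N"
        using neighborhood_contains_cylinder x by blast
      then obtain n0 where n0: "\<forall>y\<in>V n0. \<forall>i\<in>Q. y i = x i" using ev_fin by blast
      have "V n \<subseteq> N" if "n > n0" for n
        using dec[of n0 n] n0 Q(3) that VU[of n] ultrafilter_on_subset[OF U, of "V n"] by force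
      then show "\<exists>n0. \<forall>n>n0. V n \<subseteq> N" by blast
    qed
    moreover have "decseq V" using dec by (auto simp: decseq_def)
    moreover have "\<forall>n. V n \<in> \<U>" using VU by simp
    ultimately show ?L by (intro exI[of _ V] conjI)
  qed
  then show ?thesis
    unfolding bisequential_at_def topspace_discrete_product
    by (intro all_cong1 imp_cong conj_cong refl ultrafilter_converges_iff_coordinates[OF _ x]) simp_all
qed

end

section \<open>Ultrafilters on the space of decreasing functions\<close>

abbreviation (input) graph_point :: "'a set \<Rightarrow> ('a \<rightharpoonup> 'a) \<Rightarrow> 'a \<times> 'a \<Rightarrow> nat" where
  "graph_point T f \<equiv> restrict (indicator (Map.graph f)) (T \<times> T)"

lemma graph_point_apply:
  "a \<in> T \<Longrightarrow> b \<in> T \<Longrightarrow> graph_point T f (a, b) = (if f a = Some b then 1 else 0)"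
  by (simp add: indicator_def Map.graph_def)

context
  fixes T :: "'a set" and lt :: "'a \<Rightarrow> 'a \<Rightarrow> bool"
  assumes tree: "tree_on T lt"
begin

lemma tree_irrefl: "t \<in> T \<Longrightarrow> \<not> lt t t"
  using tree by (auto simp: tree_on_def irreflp_on_def)

lemma tree_trans: "lt s t \<Longrightarrow> lt t u \<Longrightarrow> s \<in> T \<Longrightarrow> t \<in> T \<Longrightarrow> u \<in> T \<Longrightarrow> lt s u"
  using tree unfolding tree_on_def by (meson transp_onD)

lemma tree_comparable:
  assumes "lt\<^sup>=\<^sup>= s u" "lt\<^sup>=\<^sup>= t u" "s \<in> T" "t \<in> T" "u \<in> T"
  shows "lt\<^sup>=\<^sup>= s t \<or> lt\<^sup>=\<^sup>= t s"
proof -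
  have "totalp_on {s \<in> T. lt s u} lt" using tree assms(5) by (simp add: tree_on_def)
  then show ?thesis using assms unfolding totalp_on_def by auto
qed

lemma tree_comparable_below:
  assumes "lt\<^sup>=\<^sup>= s s'" "lt\<^sup>=\<^sup>= t t'" "lt\<^sup>=\<^sup>= s' t' \<or> lt\<^sup>=\<^sup>= t' s'"
    and "s \<in> T" "s' \<in> T" "t \<in> T" "t' \<in> T"
  shows "lt\<^sup>=\<^sup>= s t \<or> lt\<^sup>=\<^sup>= t s"
proof -
  have trans: "lt\<^sup>=\<^sup>= a c" if "lt\<^sup>=\<^sup>= a b" "lt\<^sup>=\<^sup>= b c" "a \<in> T" "b \<in> T" "c \<in> T" for a b c
    using that tree_trans by auto
  show ?thesis
    using assms(3)
  proof
    assume "lt\<^sup>=\<^sup>= s' t'"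
    then have "lt\<^sup>=\<^sup>= s t'" using trans assms by blast
    then show ?thesis using tree_comparable assms by blast
  next
    assume "lt\<^sup>=\<^sup>= t' s'"
    then have "lt\<^sup>=\<^sup>= t s'" using trans assms by blast
    then show ?thesis using tree_comparable assms by blast
  qed
qed

lemma tree_minimal_below:
  assumes t: "t \<in> T" "Q t"
  obtains r where "r \<in> T" "lt\<^sup>=\<^sup>= r t" "Q r" "\<And>s. s \<in> T \<Longrightarrow> lt s r \<Longrightarrow> \<not> Q s"
proof (cases "\<exists>s\<in>T. lt s t \<and> Q s")
  case False
  then show ?thesis using that[of t] t by auto
next
  case True
  define A where "A = {s \<in> T. lt s t}"
  have "wfp_on A lt" using tree t(1) by (simp add: tree_on_def A_def)
  moreover have "{s \<in> A. Q s} \<subseteq> A" "{s \<in> A. Q s} \<noteq> {}" using True by (auto simp: A_def)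
  ultimately obtain r where r: "r \<in> {s \<in> A. Q s}" "\<forall>y. lt y r \<longrightarrow> y \<notin> {s \<in> A. Q s}"
    unfolding wfp_on_iff_ex_minimal by metis
  have "\<not> Q s" if s: "s \<in> T" "lt s r" for s
  proof
    assume "Q s"
    have "lt s t" using tree_trans[OF s(2)] r(1) s(1) t(1) by (simp add: A_def)
    then show False using r(2) s \<open>Q s\<close> by (simp add: A_def)
  qed
  then show ?thesis using that[of r] r(1) by (simp add: A_def)
qed

lemma chain_subset_branch:
  assumes "pred_on.chain T lt C"
  obtains B where "branch T lt B" "C \<subseteq> B"
proof -
  define Q where "Q = {D. C \<subseteq> D \<and> pred_on.chain T lt D}"
  have "\<exists>M\<in>Q. \<forall>D\<in>Q. M \<subseteq> D \<longrightarrow> D = M"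
  proof (rule subset_Zorn_nonempty)
    show "Q \<noteq> {}" using assms by (auto simp: Q_def)
    fix \<C> assume ne: "\<C> \<noteq> {}" and ch: "subset.chain Q \<C>"
    have D: "C \<subseteq> D" "D \<subseteq> T" "\<And>x y. x \<in> D \<Longrightarrow> y \<in> D \<Longrightarrow> lt\<^sup>=\<^sup>= x y \<or> lt\<^sup>=\<^sup>= y x" if "D \<in> \<C>" for D
      using ch that unfolding subset_chain_def pred_on.chain_def Q_def by auto
    have "lt\<^sup>=\<^sup>= x y \<or> lt\<^sup>=\<^sup>= y x" if xy: "x \<in> \<Union>\<C>" "y \<in> \<Union>\<C>" for x y
    proof -
      obtain D E where "D \<in> \<C>" "x \<in> D" "E \<in> \<C>" "y \<in> E" using xy by blast
      moreover have "D \<subseteq> E \<or> E \<subseteq> D"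
        using ch calculation unfolding subset_chain_def by blast
      ultimately show ?thesis using D(3) by blast
    qed
    moreover have "C \<subseteq> \<Union>\<C>" "\<Union>\<C> \<subseteq> T" using ne D(1,2) by blast+
    ultimately show "\<Union>\<C> \<in> Q" unfolding pred_on.chain_def Q_def by simp
  qed
  then obtain M where M: "M \<in> Q" and max: "\<forall>D\<in>Q. M \<subseteq> D \<longrightarrow> D = M" ..
  have "\<not> M \<subset> D" if "pred_on.chain T lt D" for D
  proof
    assume "M \<subset> D"
    then have "D \<in> Q" using M that by (auto simp: Q_def)
    then show False using max \<open>M \<subset> D\<close> by blast
  qed
  then have "branch T lt M" using M by (simp add: branch_def pred_on.maxchain_def Q_def)
  moreover have "C \<subseteq> M" using M by (simp add: Q_def)
  ultimately show ?thesis by (rule that)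
qed

lemma graph_point_in_X_set:
  assumes "dom f \<subseteq> T" "ran f \<subseteq> T" "strictly_decreasing lt f"
    and "\<And>s t. s \<in> dom f \<Longrightarrow> t \<in> dom f \<Longrightarrow> lt\<^sup>=\<^sup>= s t \<or> lt\<^sup>=\<^sup>= t s"
  shows "graph_point T f \<in> X_set T lt"
  using assms unfolding X_set_def strongly_strictly_decreasing_def pred_on.chain_def by blast

lemma X_set_subset: "X_set T lt \<subseteq> (\<Pi>\<^sub>E p\<in>T \<times> T. {0, 1})"
  unfolding X_set_def by (auto simp: indicator_def)

lemma X_set_binary: "G \<in> X_set T lt \<Longrightarrow> a \<in> T \<Longrightarrow> b \<in> T \<Longrightarrow> G (a, b) = 0 \<or> G (a, b) = 1"
  using PiE_mem[OF subsetD[OF X_set_subset], of G "(a, b)"] by simp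

lemma X_setE:
  assumes "G \<in> X_set T lt"
  obtains f where "\<forall>a\<in>T. \<forall>b\<in>T. G (a, b) = 1 \<longleftrightarrow> f a = Some b"
    and "\<forall>s\<in>dom f. \<forall>t\<in>dom f. lt\<^sup>=\<^sup>= s t \<or> lt\<^sup>=\<^sup>= t s"
proof -
  obtain f where "G = graph_point T f" and ch: "pred_on.chain T lt (dom f)"
    using assms unfolding X_set_def strongly_strictly_decreasing_def by blast
  then have "\<forall>a\<in>T. \<forall>b\<in>T. G (a, b) = 1 \<longleftrightarrow> f a = Some b"
    using graph_point_apply[of _ T _ f] by simp
  moreover have "\<forall>s\<in>dom f. \<forall>t\<in>dom f. lt\<^sup>=\<^sup>= s t \<or> lt\<^sup>=\<^sup>= t s"
    using ch by (simp add: pred_on.chain_def)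
  ultimately show ?thesis by (rule that)
qed

lemma X_set_functional:
  assumes "G \<in> X_set T lt" "G (a, b) = 1" "G (a, c) = 1" "a \<in> T" "b \<in> T" "c \<in> T"
  shows "b = c"
proof -
  obtain f where f: "\<forall>a\<in>T. \<forall>b\<in>T. G (a, b) = 1 \<longleftrightarrow> f a = Some b"
    by (rule X_setE[OF assms(1)])
  have "f a = Some b" "f a = Some c" using f assms by blast+
  then show ?thesis by simp
qed

lemma X_set_domain_comparable:
  assumes "G \<in> X_set T lt" "G (a, b) = 1" "G (a', b') = 1" "a \<in> T" "b \<in> T" "a' \<in> T" "b' \<in> T"
  shows "lt\<^sup>=\<^sup>= a a' \<or> lt\<^sup>=\<^sup>= a' a"
proof -
  obtain f where f: "\<forall>a\<in>T. \<forall>b\<in>T. G (a, b) = 1 \<longleftrightarrow> f a = Some b"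
    and comp: "\<forall>s\<in>dom f. \<forall>t\<in>dom f. lt\<^sup>=\<^sup>= s t \<or> lt\<^sup>=\<^sup>= t s"
    by (rule X_setE[OF assms(1)])
  have "f a = Some b" "f a' = Some b'" using f assms by blast+
  then have "a \<in> dom f" "a' \<in> dom f" by auto
  then show ?thesis by (intro comp[rule_format])
qed

lemma bisequential_X_space_iff:
  "bisequential (X_space T lt) \<longleftrightarrow>
    (\<forall>F\<in>X_set T lt. \<forall>\<U>.
      ultrafilter_on (X_set T lt) \<U> \<and> (\<forall>p\<in>T \<times> T. {G \<in> X_set T lt. G p = F p} \<in> \<U>) \<longrightarrow>
      (\<exists>\<C>. countable \<C> \<and> \<C> \<subseteq> \<U> \<and> (\<forall>p\<in>T \<times> T. \<exists>A\<in>\<C>. \<forall>G\<in>A. G p = F p)))"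
  unfolding bisequential_def topspace_discrete_product[OF X_set_subset X_space_def]
  by (intro ball_cong refl bisequential_at_iff_coordinates[OF X_set_subset X_space_def])

text \<open>Both necessity arguments refute bisequentiality at the empty function.\<close>

lemma bisequential_X_space_empty:
  assumes bi: "bisequential (X_space T lt)" and U: "ultrafilter_on (X_set T lt) \<U>"
    and conv: "\<And>a b. a \<in> T \<Longrightarrow> b \<in> T \<Longrightarrow> {G \<in> X_set T lt. G (a, b) = 0} \<in> \<U>"
  obtains \<C> where "countable \<C>" "\<C> \<subseteq> \<U>" "\<forall>a\<in>T. \<forall>b\<in>T. \<exists>A\<in>\<C>. \<forall>G\<in>A. G (a, b) = 0"
proof -
  let ?F = "graph_point T Map.empty"
  have F0: "?F (a, b) = 0" if "a \<in> T" "b \<in> T" for a b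
    using graph_point_apply[OF that, of Map.empty] by simp
  have FX: "?F \<in> X_set T lt"
    by (intro graph_point_in_X_set) (auto simp: strictly_decreasing_def)
  have "{G \<in> X_set T lt. G p = ?F p} \<in> \<U>" if "p \<in> T \<times> T" for p
    using that conv F0 by (cases p) (simp only: mem_Sigma_iff)
  with U have "ultrafilter_on (X_set T lt) \<U> \<and> (\<forall>p\<in>T \<times> T. {G \<in> X_set T lt. G p = ?F p} \<in> \<U>)"
    by (intro conjI ballI)
  from bspec[OF bi[unfolded bisequential_X_space_iff] FX, THEN spec, THEN mp, OF this]
  obtain \<C> where C: "countable \<C>" "\<C> \<subseteq> \<U>" "\<forall>p\<in>T \<times> T. \<exists>A\<in>\<C>. \<forall>G\<in>A. G p = ?F p"
    by (elim exE conjE)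
  have "\<exists>A\<in>\<C>. \<forall>G\<in>A. G (a, b) = 0" if "a \<in> T" "b \<in> T" for a b
    using bspec[OF C(3), of "(a, b)"] F0[OF that] that by (simp only: mem_Sigma_iff)
  then have "\<forall>a\<in>T. \<forall>b\<in>T. \<exists>A\<in>\<C>. \<forall>G\<in>A. G (a, b) = 0" by blast
  with C(1,2) show ?thesis by (rule that)
qed

section \<open>Necessity of the cardinality bound\<close>

text \<open>A countably complete ultrafilter on \<open>T\<close> is copied onto the one-point functions
  \<open>t \<mapsto> t\<close>. If it is nonprincipal the copy converges to the empty function, but
  countably many of its members have a common element, which takes a value that one of them
  should exclude.\<close>

lemma bisequential_imp_below_first_measurable:
  assumes bi: "bisequential (X_space T lt)"
  shows "below_first_measurable T"
  unfolding below_first_measurable_iff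
proof (rule notI, elim exE conjE)
  fix \<V> assume V: "ultrafilter_on T \<V>" and np: "nonprincipal T \<V>" and cc: "countably_complete \<V>"
  define g where "g t = graph_point T [t \<mapsto> t]" for t
  have g_apply: "g t (a, b) = (if a = t \<and> b = t then 1 else 0)" if "a \<in> T" "b \<in> T" for t a b
    using graph_point_apply[OF that, of "[t \<mapsto> t]"] by (auto simp: g_def)
  have gX: "g t \<in> X_set T lt" if "t \<in> T" for t
    unfolding g_def using that tree_irrefl
    by (intro graph_point_in_X_set) (auto simp: strictly_decreasing_def split: if_splits)
  define \<U> where "\<U> = {B. B \<subseteq> X_set T lt \<and> {t \<in> T. g t \<in> B} \<in> \<V>}"
  have U: "ultrafilter_on (X_set T lt) \<U>"
    unfolding \<U>_def using gX by (intro ultrafilter_on_image[OF V]) blast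
  have conv: "{G \<in> X_set T lt. G (a, b) = 0} \<in> \<U>" if ab: "a \<in> T" "b \<in> T" for a b
  proof -
    have "{a} \<notin> \<V>" using np nonprincipal_iff[OF V] by blast
    then have "T - {a} \<in> \<V>" using ultrafilter_on_Diff_iff[OF V, of "{a}"] ab by simp
    moreover have "T - {a} \<subseteq> {t \<in> T. g t \<in> {G \<in> X_set T lt. G (a, b) = 0}}"
      using g_apply[OF ab] gX by auto
    ultimately have "{t \<in> T. g t \<in> {G \<in> X_set T lt. G (a, b) = 0}} \<in> \<V>"
      using ultrafilter_on_mono[OF V] by (metis (no_types, lifting) mem_Collect_eq subsetI)
    then show ?thesis unfolding \<U>_def by simp
  qed
  obtain \<C> where C: "countable \<C>" "\<C> \<subseteq> \<U>"
      and dec: "\<forall>a\<in>T. \<forall>b\<in>T. \<exists>A\<in>\<C>. \<forall>G\<in>A. G (a, b) = 0"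
    by (rule bisequential_X_space_empty[OF bi U conv])
  have "T \<noteq> {}" using ultrafilter_on_space[OF V] ultrafilter_on_nonempty[OF V] by metis
  then obtain t0 where "t0 \<in> T" by blast
  from dec[rule_format, OF this this] have ne: "\<C> \<noteq> {}" by blast
  have "{t \<in> T. g t \<in> A} \<in> \<V>" if "A \<in> \<C>" for A
    using subsetD[OF C(2) that] by (simp add: \<U>_def)
  then have "(\<Inter>A\<in>\<C>. {t \<in> T. g t \<in> A}) \<in> \<V>"
    by (rule Inter_countable_family[OF cc C(1) ne])
  then have "(\<Inter>A\<in>\<C>. {t \<in> T. g t \<in> A}) \<noteq> {}" by (rule ultrafilter_on_nonempty[OF V])
  then obtain t where "t \<in> (\<Inter>A\<in>\<C>. {t \<in> T. g t \<in> A})" by blast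
  with ne have t: "t \<in> T" "\<And>A. A \<in> \<C> \<Longrightarrow> g t \<in> A" by auto
  from dec[rule_format, OF t(1) t(1)] obtain A where "A \<in> \<C>" "\<forall>G\<in>A. G (t, t) = 0" by blast
  then have "g t (t, t) = 0" using t(2) by blast
  then show False using g_apply[OF t(1) t(1), of t] by simp
qed

section \<open>Necessity of countable branches\<close>

text \<open>The elements of the chain with countably many predecessors in it form an initial segment of
  order type \<open>\<omega>\<^sub>1\<close>: if the segment is proper, a minimal element outside it has uncountably many
  predecessors, and they all belong to the segment.\<close>

lemma uncountable_chain_contains_omega1:
  assumes ch: "pred_on.chain T lt C" and unc: "uncountable C"
  obtains H where "H \<subseteq> C" "uncountable H" "\<And>h. h \<in> H \<Longrightarrow> countable {c \<in> H. lt c h}"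
proof -
  define H where "H = {h \<in> C. countable {c \<in> C. lt c h}}"
  have CT: "C \<subseteq> T" using ch by (simp add: pred_on.chain_def)
  have pred: "countable {c \<in> H. lt c h}" if "h \<in> H" for h
    using that by (auto simp: H_def intro: countable_subset[of _ "{c \<in> C. lt c h}"])
  have "uncountable H"
  proof (cases "H = C")
    case True
    then show ?thesis using unc by simp
  next
    case False
    then obtain t where "t \<in> C - H" by (auto simp: H_def)
    then obtain r where r: "r \<in> C - H" "\<And>s. s \<in> T \<Longrightarrow> lt s r \<Longrightarrow> s \<notin> C - H"
      using tree_minimal_below[of t "\<lambda>t. t \<in> C - H"] CT by (metis DiffD1 subsetD)
    then have "uncountable {c \<in> C. lt c r}" by (simp add: H_def)
    moreover have "{c \<in> C. lt c r} \<subseteq> H" using r(2) CT by blast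
    ultimately show ?thesis using countable_subset by blast
  qed
  then show ?thesis using that[of H] pred by (auto simp: H_def)
qed

text \<open>The set \<open>H\<close> is a copy of \<open>\<omega>\<^sub>1\<close> in \<open>T\<close>: every countable subset has an upper bound in every
  uncountable subset.\<close>

context
  fixes H :: "'a set"
  assumes HT: "H \<subseteq> T" and H_unc: "uncountable H"
    and H_comp: "\<And>x y. x \<in> H \<Longrightarrow> y \<in> H \<Longrightarrow> lt\<^sup>=\<^sup>= x y \<or> lt\<^sup>=\<^sup>= y x"
    and H_pred: "\<And>h. h \<in> H \<Longrightarrow> countable {c \<in> H. lt c h}"
begin

definition large :: "('a \<times> 'a) set \<Rightarrow> bool" where
  "large W \<longleftrightarrow> uncountable {a \<in> H. uncountable {b \<in> H. (a, b) \<in> W}}"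

lemma uncountable_has_upper_bound:
  assumes A: "A \<subseteq> H" "uncountable A" and C: "C \<subseteq> H" "countable C"
  obtains a where "a \<in> A" "\<And>c. c \<in> C \<Longrightarrow> lt c a"
proof -
  have "countable (\<Union>c\<in>C. insert c {h \<in> H. lt h c})"
    using C H_pred by (intro countable_UN countable_insert) blast+
  then have "\<not> A \<subseteq> (\<Union>c\<in>C. insert c {h \<in> H. lt h c})"
    using A(2) countable_subset by blast
  then obtain a where a: "a \<in> A" "a \<notin> (\<Union>c\<in>C. insert c {h \<in> H. lt h c})" by blast
  have "lt c a" if "c \<in> C" for c
    using H_comp[of c a] a that A(1) C(1) by auto
  then show ?thesis using that a(1) by blast
qed

text \<open>Going through the sets, the arguments are chosen increasingly, each with an uncountable
  section; then, going back, each value is chosen in its section above all values chosen before.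
  The bound \<open>C\<close> on the domain carries the earlier arguments through the induction.\<close>

lemma decreasing_function_through_large_sets:
  assumes "finite \<W>" "\<And>W. W \<in> \<W> \<Longrightarrow> large W" "countable C" "C \<subseteq> H"
  shows "\<exists>f. finite (dom f) \<and> dom f \<subseteq> H \<and> ran f \<subseteq> H \<and> strictly_decreasing lt f \<and>
    (\<forall>c\<in>C. \<forall>s\<in>dom f. lt c s) \<and> (\<forall>W\<in>\<W>. \<exists>a b. f a = Some b \<and> (a, b) \<in> W)"
  using assms
proof (induction \<W> arbitrary: C)
  case empty
  show ?case by (intro exI[of _ Map.empty]) (simp add: strictly_decreasing_def)
next
  case (insert W \<W>)
  have "uncountable {a \<in> H. uncountable {b \<in> H. (a, b) \<in> W}}"
    using insert.prems(1)[of W] by (simp add: large_def)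
  then obtain a where a: "a \<in> H" "uncountable {b \<in> H. (a, b) \<in> W}" "\<And>c. c \<in> C \<Longrightarrow> lt c a"
    using uncountable_has_upper_bound[of "{a \<in> H. uncountable {b \<in> H. (a, b) \<in> W}}" C] insert.prems(2,3)
    by (metis (no_types, lifting) mem_Collect_eq subsetI)
  obtain f where f: "finite (dom f)" "dom f \<subseteq> H" "ran f \<subseteq> H" "strictly_decreasing lt f"
    and above: "\<forall>c\<in>insert a C. \<forall>s\<in>dom f. lt c s"
    and hits: "\<forall>W\<in>\<W>. \<exists>a b. f a = Some b \<and> (a, b) \<in> W"
    using insert.IH[of "insert a C"] insert.prems a(1) by auto
  have "finite (ran f)" using f(1) by (rule finite_ran)
  then obtain b where b: "b \<in> H" "(a, b) \<in> W" "\<And>c. c \<in> ran f \<Longrightarrow> lt c b"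
    using uncountable_has_upper_bound[of "{b \<in> H. (a, b) \<in> W}" "ran f"] a(2) f(3)
    by (metis (no_types, lifting) countable_finite mem_Collect_eq subsetI)
  have a_new: "a \<notin> dom f" using above tree_irrefl a(1) HT by blast
  have not_below: "\<not> lt s a" if "s \<in> dom f" for s
    using above that tree_trans[of a s a] tree_irrefl[of a] a(1) f(2) HT by blast
  have "strictly_decreasing lt (f(a \<mapsto> b))"
    unfolding strictly_decreasing_def
  proof (intro ballI impI)
    fix s t assume st: "s \<in> dom (f(a \<mapsto> b))" "t \<in> dom (f(a \<mapsto> b))" "lt s t"
    have "t \<noteq> a" using st not_below tree_irrefl[of a] a(1) HT by auto
    then have t: "t \<in> dom f" using st(2) by simp
    show "lt (the ((f(a \<mapsto> b)) t)) (the ((f(a \<mapsto> b)) s))"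
    proof (cases "s = a")
      case True
      have "the (f t) \<in> ran f" using t by (auto simp: ran_def)
      then show ?thesis using True \<open>t \<noteq> a\<close> b(3) by simp
    next
      case False
      then show ?thesis using st t \<open>t \<noteq> a\<close> f(4) by (auto simp: strictly_decreasing_def)
    qed
  qed
  moreover have "ran (f(a \<mapsto> b)) \<subseteq> H" using a_new b(1) f(3) by (simp add: domIff)
  moreover have "\<forall>W'\<in>insert W \<W>. \<exists>a' b'. (f(a \<mapsto> b)) a' = Some b' \<and> (a', b') \<in> W'"
  proof
    fix W' assume W': "W' \<in> insert W \<W>"
    show "\<exists>a' b'. (f(a \<mapsto> b)) a' = Some b' \<and> (a', b') \<in> W'"
    proof (cases "W' = W")
      case True
      then show ?thesis using b(2) by (intro exI[of _ a] exI[of _ b]) simp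
    next
      case False
      then have "W' \<in> \<W>" using W' by simp
      from bspec[OF hits this] obtain a' b' where "f a' = Some b'" "(a', b') \<in> W'" by (elim exE conjE)
      moreover from this have "a' \<noteq> a" using a_new by auto
      ultimately show ?thesis by (intro exI[of _ a'] exI[of _ b']) simp
    qed
  qed
  moreover have "\<forall>c\<in>C. \<forall>s\<in>dom (f(a \<mapsto> b)). lt c s" using above a(3) by simp
  moreover have "finite (dom (f(a \<mapsto> b)))" "dom (f(a \<mapsto> b)) \<subseteq> H" using f a(1) by simp_all
  ultimately show ?case by (intro exI[of _ "f(a \<mapsto> b)"] conjI)
qed

text \<open>Otherwise, apart from countably many exceptions, an element of \<open>H\<close> has only countable sections,
  and these could not cover \<open>H\<close>.\<close>

lemma countable_cover_has_large_member:
  assumes "countable \<C>" and cover: "\<And>a b. a \<in> H \<Longrightarrow> b \<in> H \<Longrightarrow> \<exists>A\<in>\<C>. (a, b) \<in> W A"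
  shows "\<exists>A\<in>\<C>. large (W A)"
proof (rule ccontr)
  assume none: "\<not> ?thesis"
  define N where "N = (\<Union>A\<in>\<C>. {a \<in> H. uncountable {b \<in> H. (a, b) \<in> W A}})"
  have "countable {a \<in> H. uncountable {b \<in> H. (a, b) \<in> W A}}" if "A \<in> \<C>" for A
    using none that by (auto simp: large_def)
  then have "countable N" unfolding N_def using assms(1) by simp
  then have "uncountable (H - N)" using H_unc by (simp add: uncountable_minus_countable)
  then obtain a where "a \<in> H - N" by (metis countable_empty ex_in_conv)
  then have a: "a \<in> H" "\<And>A. A \<in> \<C> \<Longrightarrow> countable {b \<in> H. (a, b) \<in> W A}"
    by (auto simp: N_def)
  have "countable (\<Union>A\<in>\<C>. {b \<in> H. (a, b) \<in> W A})"
    using assms(1) a(2) by (rule countable_UN)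
  moreover have "b \<in> (\<Union>A\<in>\<C>. {b \<in> H. (a, b) \<in> W A})" if "b \<in> H" for b
    using cover[OF a(1) that] that by simp
  then have "H \<subseteq> (\<Union>A\<in>\<C>. {b \<in> H. (a, b) \<in> W A})" ..
  ultimately show False using H_unc countable_subset by metis
qed

text \<open>An ultrafilter of functions that avoid each pair but meet each large set cannot contain
  a countable family deciding all pairs: the pairs avoided by some member of the family would
  form a large set.\<close>

lemma not_bisequential_if_omega1: "\<not> bisequential (X_space T lt)"
proof
  assume bi: "bisequential (X_space T lt)"
  define hit where "hit W = {G \<in> X_set T lt. \<exists>a\<in>T. \<exists>b\<in>T. (a, b) \<in> W \<and> G (a, b) = 1}" for W
  define miss where "miss p = {G \<in> X_set T lt. G p = 0}" for p
  have fip: "X_set T lt \<inter> \<Inter>\<F> \<noteq> {}"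
    if F: "finite \<F>" "\<F> \<subseteq> hit ` Collect large \<union> miss ` (T \<times> T)" for \<F>
  proof -
    obtain \<W> where W: "\<W> \<subseteq> Collect large" "finite \<W>" "\<F> \<inter> hit ` Collect large = hit ` \<W>"
      using finite_subset_image[of "\<F> \<inter> hit ` Collect large" hit "Collect large"] F(1) by auto
    obtain Q where Q: "Q \<subseteq> T \<times> T" "finite Q" "\<F> \<inter> miss ` (T \<times> T) = miss ` Q"
      using finite_subset_image[of "\<F> \<inter> miss ` (T \<times> T)" miss "T \<times> T"] F(1) by auto
    \<comment> \<open>A domain above the first coordinates of \<open>Q\<close> keeps the function away from \<open>Q\<close>.\<close>
    have "large W" if "W \<in> \<W>" for W using W(1) that by auto
    moreover have "countable (fst ` Q \<inter> H)" using Q(2) by (simp add: countable_finite)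
    ultimately have "\<exists>f. finite (dom f) \<and> dom f \<subseteq> H \<and> ran f \<subseteq> H \<and> strictly_decreasing lt f \<and>
        (\<forall>c\<in>fst ` Q \<inter> H. \<forall>s\<in>dom f. lt c s) \<and> (\<forall>W\<in>\<W>. \<exists>a b. f a = Some b \<and> (a, b) \<in> W)"
      by (intro decreasing_function_through_large_sets W(2)) auto
    then obtain f where f: "dom f \<subseteq> H" "ran f \<subseteq> H" "strictly_decreasing lt f"
      and above: "\<forall>c\<in>fst ` Q \<inter> H. \<forall>s\<in>dom f. lt c s"
      and hits: "\<forall>W\<in>\<W>. \<exists>a b. f a = Some b \<and> (a, b) \<in> W"
      by (elim exE conjE)
    let ?G = "graph_point T f"
    have GX: "?G \<in> X_set T lt"
    proof (rule graph_point_in_X_set)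
      show "dom f \<subseteq> T" "ran f \<subseteq> T" using f HT by (meson subset_trans)+
      show "lt\<^sup>=\<^sup>= s t \<or> lt\<^sup>=\<^sup>= t s" if "s \<in> dom f" "t \<in> dom f" for s t
        using H_comp[OF subsetD[OF f(1) that(1)] subsetD[OF f(1) that(2)]] .
    qed (rule f(3))
    have G_hit: "?G \<in> hit W" if "W \<in> \<W>" for W
    proof -
      from bspec[OF hits that] obtain a b where ab: "f a = Some b" "(a, b) \<in> W"
        by (elim exE conjE)
      have "a \<in> dom f" "b \<in> ran f" using ab(1) by (auto intro: ranI)
      then have "a \<in> T" "b \<in> T" using f HT by auto
      moreover from this have "?G (a, b) = 1" using ab(1) graph_point_apply[of a T b f] by simp
      ultimately have "\<exists>a\<in>T. \<exists>b\<in>T. (a, b) \<in> W \<and> ?G (a, b) = 1" using ab(2) by blast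
      then show ?thesis using GX by (simp only: hit_def mem_Collect_eq)
    qed
    have G_miss: "?G \<in> miss p" if "p \<in> Q" for p
    proof (cases p)
      case (Pair a b)
      have "f a \<noteq> Some b"
      proof
        assume "f a = Some b"
        then have "a \<in> dom f" "a \<in> H" using f(1) by auto
        moreover have "a \<in> fst ` Q" using that Pair by force
        ultimately have "lt a a" using above by blast
        then show False using tree_irrefl \<open>a \<in> H\<close> HT by blast
      qed
      moreover have "a \<in> T" "b \<in> T" using that Q(1) Pair by auto
      ultimately have "?G p = 0" using graph_point_apply[of a T b f] Pair by simp
      then show ?thesis using GX by (simp only: miss_def mem_Collect_eq)
    qed
    have "?G \<in> A" if "A \<in> \<F>" for A
    proof -
      have "A \<in> \<F> \<inter> hit ` Collect large \<or> A \<in> \<F> \<inter> miss ` (T \<times> T)"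
        using subsetD[OF F(2) that] that by (simp only: Int_iff Un_iff simp_thms)
      then have "A \<in> hit ` \<W> \<or> A \<in> miss ` Q" by (simp only: W(3) Q(3))
      then show ?thesis using G_hit G_miss by (elim disjE imageE) simp_all
    qed
    then show ?thesis using GX by blast
  qed
  have "hit ` Collect large \<union> miss ` (T \<times> T) \<subseteq> Pow (X_set T lt)"
    by (auto simp: hit_def miss_def)
  then obtain \<U> where U: "ultrafilter_on (X_set T lt) \<U>"
      and sub: "hit ` Collect large \<union> miss ` (T \<times> T) \<subseteq> \<U>"
    by (rule ultrafilter_extension[OF _ fip])
  have conv: "{G \<in> X_set T lt. G (a, b) = 0} \<in> \<U>" if "a \<in> T" "b \<in> T" for a b
  proof -
    have "miss (a, b) \<in> \<U>" using sub that by blast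
    then show ?thesis by (simp add: miss_def)
  qed
  obtain \<C> where C: "countable \<C>" "\<C> \<subseteq> \<U>"
      and dec: "\<forall>a\<in>T. \<forall>b\<in>T. \<exists>A\<in>\<C>. \<forall>G\<in>A. G (a, b) = 0"
    by (rule bisequential_X_space_empty[OF bi U conv])
  have "\<exists>A\<in>\<C>. large {p. \<forall>G\<in>A. G p = 0}"
    using dec HT by (intro countable_cover_has_large_member[OF C(1)]) (simp add: subsetD)
  then obtain A where A: "A \<in> \<C>" "large {p. \<forall>G\<in>A. G p = 0}" by blast
  then have "hit {p. \<forall>G\<in>A. G p = 0} \<in> \<U>" using sub by blast
  then have "A \<inter> hit {p. \<forall>G\<in>A. G p = 0} \<noteq> {}"
    using ultrafilter_on_nonempty[OF U ultrafilter_on_Int[OF U]] A(1) C(2) by blast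
  then show False by (auto simp: hit_def)
qed

end

lemma bisequential_imp_countable_branch:
  assumes bi: "bisequential (X_space T lt)" and B: "branch T lt B"
  shows "countable B"
proof (rule ccontr)
  assume unc: "uncountable B"
  have ch: "pred_on.chain T lt B" using B by (simp add: branch_def pred_on.maxchain_def)
  then have B: "B \<subseteq> T" "\<And>x y. x \<in> B \<Longrightarrow> y \<in> B \<Longrightarrow> lt\<^sup>=\<^sup>= x y \<or> lt\<^sup>=\<^sup>= y x"
    unfolding pred_on.chain_def by blast+
  obtain H where H: "H \<subseteq> B" "uncountable H" "\<And>h. h \<in> H \<Longrightarrow> countable {c \<in> H. lt c h}"
    using uncountable_chain_contains_omega1[OF ch unc] by metis
  have "H \<subseteq> T" "\<And>x y. x \<in> H \<Longrightarrow> y \<in> H \<Longrightarrow> lt\<^sup>=\<^sup>= x y \<or> lt\<^sup>=\<^sup>= y x"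
    using H(1) B by blast+
  from not_bisequential_if_omega1[OF this(1) H(2) this(2) H(3)] bi show False by blast
qed

section \<open>Sufficiency\<close>

text \<open>The points \<open>t\<close> such that the domain of almost every function contains a point \<open>\<ge> t\<close> form a
  countable chain \<open>P\<close>. Over each point of \<open>P\<close> the possible values give a disjoint family to be decided. Outside \<open>P\<close> it is enough to
  decide which of the cones above the minimal points of the complement contains part of the
  domain.\<close>

lemma bisequential_if_countable_branches:
  assumes below: "below_first_measurable T" and br: "\<And>B. branch T lt B \<Longrightarrow> countable B"
  shows "bisequential (X_space T lt)"
  unfolding bisequential_X_space_iff
proof (intro ballI allI impI, elim conjE)
  fix F \<U>
  assume U: "ultrafilter_on (X_set T lt) \<U>"
    and conv: "\<forall>p\<in>T \<times> T. {G \<in> X_set T lt. G p = F p} \<in> \<U>"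
  define above where
    "above t = {G \<in> X_set T lt. \<exists>s\<in>T. \<exists>u\<in>T. lt\<^sup>=\<^sup>= t s \<and> G (s, u) = 1}" for t
  define P where "P = {t \<in> T. above t \<in> \<U>}"
  have above_comparable: "lt\<^sup>=\<^sup>= s t \<or> lt\<^sup>=\<^sup>= t s"
    if "G \<in> above s" "G \<in> above t" "s \<in> T" "t \<in> T" for G s t
  proof -
    obtain s' u where s': "s' \<in> T" "u \<in> T" "lt\<^sup>=\<^sup>= s s'" "G (s', u) = 1"
      using \<open>G \<in> above s\<close> unfolding above_def by blast
    obtain t' v where t': "t' \<in> T" "v \<in> T" "lt\<^sup>=\<^sup>= t t'" "G (t', v) = 1"
      using \<open>G \<in> above t\<close> unfolding above_def by blast
    have "G \<in> X_set T lt" using \<open>G \<in> above s\<close> by (simp add: above_def)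
    then have "lt\<^sup>=\<^sup>= s' t' \<or> lt\<^sup>=\<^sup>= t' s'"
      using X_set_domain_comparable s' t' by metis
    then show ?thesis using tree_comparable_below[OF s'(3) t'(3)] s' t' that by blast
  qed
  have "lt\<^sup>=\<^sup>= s t \<or> lt\<^sup>=\<^sup>= t s" if "s \<in> P" "t \<in> P" for s t
  proof -
    have "above s \<inter> above t \<in> \<U>" using ultrafilter_on_Int[OF U] that by (simp add: P_def)
    then obtain G where "G \<in> above s" "G \<in> above t" using ultrafilter_on_nonempty[OF U] by blast
    then show ?thesis using above_comparable that by (simp add: P_def)
  qed
  then have "pred_on.chain T lt P" unfolding pred_on.chain_def by (auto simp: P_def)
  then have P: "countable P" using chain_subset_branch br countable_subset by metis

  define decides where "decides \<C> E \<longleftrightarrow>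
    countable \<C> \<and> \<C> \<subseteq> \<U> \<and> (\<forall>t\<in>T. \<exists>A\<in>\<C>. A \<subseteq> E t \<or> A \<inter> E t = {})"
    for \<C> and E :: "'a \<Rightarrow> ('a \<times> 'a \<Rightarrow> nat) set"
  have decidable: "\<exists>\<C>. decides \<C> E"
    if "\<And>G s t. s \<in> T \<Longrightarrow> t \<in> T \<Longrightarrow> G \<in> E s \<Longrightarrow> G \<in> E t \<Longrightarrow> s = t" "\<And>t. E t \<subseteq> X_set T lt" for E
    unfolding decides_def using that
    by (intro countably_many_decide_disjoint_family[OF below U]) (auto simp: disjoint_family_on_def)

  define val where "val p u = {G \<in> X_set T lt. G (p, u) = 1}" for p u
  have "\<exists>\<C>. decides \<C> (val p)" if p: "p \<in> P" for p
  proof (rule decidable)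
    have "p \<in> T" using p by (simp add: P_def)
    then show "s = t" if "s \<in> T" "t \<in> T" "G \<in> val p s" "G \<in> val p t" for G s t
      using X_set_functional[of G p s t] that by (simp add: val_def)
  qed (simp add: val_def)
  then have "\<forall>p\<in>P. \<exists>\<C>. decides \<C> (val p)" by blast
  then obtain \<C> where "\<forall>p\<in>P. decides (\<C> p) (val p)"
    by (elim bchoice[THEN exE])
  then have C: "countable (\<C> p)" "\<C> p \<subseteq> \<U>" "\<forall>u\<in>T. \<exists>A\<in>\<C> p. A \<subseteq> val p u \<or> A \<inter> val p u = {}"
    if "p \<in> P" for p
    using that by (simp_all add: decides_def)

  \<comment> \<open>Two distinct minimal points of \<open>T - P\<close> are incomparable, so a chain meets at most one of
    their cones.\<close>
  define R where "R = {r \<in> T - P. \<forall>s\<in>T. lt s r \<longrightarrow> s \<in> P}"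
  define cone where "cone r = (if r \<in> R then above r else {})" for r
  have "\<exists>\<D>. decides \<D> cone"
  proof (rule decidable)
    show "s = t" if "s \<in> T" "t \<in> T" "G \<in> cone s" "G \<in> cone t" for G s t
    proof -
      have R: "s \<in> R" "t \<in> R" "G \<in> above s" "G \<in> above t"
        using that by (auto simp: cone_def split: if_splits)
      then show ?thesis using above_comparable[OF R(3,4) that(1,2)] that(1,2) by (auto simp: R_def)
    qed
  qed (simp add: cone_def above_def)
  then obtain \<D> where "decides \<D> cone" ..
  then have D: "countable \<D>" "\<D> \<subseteq> \<U>" "\<forall>r\<in>T. \<exists>A\<in>\<D>. A \<subseteq> cone r \<or> A \<inter> cone r = {}"
    by (simp_all add: decides_def)

  have AX: "A \<subseteq> X_set T lt" if "A \<in> \<U>" for A using ultrafilter_on_subset[OF U that] .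
  have decided: "\<exists>A\<in>(\<Union>p\<in>P. \<C> p) \<union> \<D>. (\<forall>G\<in>A. G (t, u) = 0) \<or> (\<forall>G\<in>A. G (t, u) = 1)"
    if tu: "t \<in> T" "u \<in> T" for t u
  proof (cases "t \<in> P")
    case True
    obtain A where A: "A \<in> \<C> t" "A \<subseteq> val t u \<or> A \<inter> val t u = {}"
      using bspec[OF C(3)[OF True] tu(2)] ..
    have "A \<subseteq> X_set T lt" using AX subsetD[OF C(2)[OF True] A(1)] .
    then have "(\<forall>G\<in>A. G (t, u) = 0) \<or> (\<forall>G\<in>A. G (t, u) = 1)"
      using A(2) X_set_binary[OF _ tu] by (auto simp: val_def)
    then show ?thesis using A(1) True by blast
  next
    case False
    then obtain r where r: "r \<in> T" "lt\<^sup>=\<^sup>= r t" "r \<notin> P" "\<And>s. s \<in> T \<Longrightarrow> lt s r \<Longrightarrow> s \<in> P"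
      using tree_minimal_below[of t "\<lambda>t. t \<notin> P"] tu(1) by metis
    then have cone: "cone r = above r" by (simp add: R_def cone_def)
    obtain A where A: "A \<in> \<D>" "A \<subseteq> above r \<or> A \<inter> above r = {}"
      using bspec[OF D(3) r(1)] unfolding cone ..
    have "A \<in> \<U>" using A(1) D(2) by blast
    \<comment> \<open>The cone is not in \<open>\<U>\<close>, as \<open>r\<close> would then belong to \<open>P\<close>.\<close>
    have "\<not> A \<subseteq> above r"
    proof
      assume "A \<subseteq> above r"
      then have "above r \<in> \<U>"
        using ultrafilter_on_mono[OF U \<open>A \<in> \<U>\<close>] by (simp add: above_def)
      then show False using r by (simp add: P_def)
    qed
    then have "A \<inter> above r = {}" using A(2) by blast
    then have "G (t, u) \<noteq> 1" if "G \<in> A" for G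
      using that AX[OF \<open>A \<in> \<U>\<close>] r(2) tu unfolding above_def by blast
    then have "\<forall>G\<in>A. G (t, u) = 0"
      using X_set_binary[OF _ tu] AX[OF \<open>A \<in> \<U>\<close>] by blast
    then show ?thesis using A(1) by blast
  qed
  have sub: "(\<Union>p\<in>P. \<C> p) \<union> \<D> \<subseteq> \<U>" using C(2) D(2) by blast
  \<comment> \<open>A value on which a member of \<open>\<U>\<close> agrees must be the value of the limit \<open>F\<close>.\<close>
  have "\<exists>A\<in>(\<Union>p\<in>P. \<C> p) \<union> \<D>. \<forall>G\<in>A. G p = F p" if p: "p \<in> T \<times> T" for p
  proof -
    obtain A where A: "A \<in> (\<Union>p\<in>P. \<C> p) \<union> \<D>" "(\<forall>G\<in>A. G p = 0) \<or> (\<forall>G\<in>A. G p = 1)"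
      using decided p by (cases p) (metis mem_Sigma_iff)
    then have "A \<inter> {G \<in> X_set T lt. G p = F p} \<in> \<U>"
      using ultrafilter_on_Int[OF U subsetD[OF sub]] conv p by blast
    then obtain G where "G \<in> A" "G p = F p" using ultrafilter_on_nonempty[OF U] by blast
    then have "\<forall>G\<in>A. G p = F p" using A(2) by metis
    then show ?thesis using A(1) by blast
  qed
  moreover have "countable ((\<Union>p\<in>P. \<C> p) \<union> \<D>)" using P C(1) D(1) by simp
  ultimately show "\<exists>\<C>. countable \<C> \<and> \<C> \<subseteq> \<U> \<and> (\<forall>p\<in>T \<times> T. \<exists>A\<in>\<C>. \<forall>G\<in>A. G p = F p)"
    using sub by (intro exI[of _ "(\<Union>p\<in>P. \<C> p) \<union> \<D>"] conjI ballI)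
qed

end

theorem theorem3p1:
  fixes T :: "'a set" and lt :: "'a \<Rightarrow> 'a \<Rightarrow> bool"
  assumes "tree_on T lt"
  shows "bisequential (X_space T lt) \<longleftrightarrow>
    below_first_measurable T \<and> (\<forall>B. branch T lt B \<longrightarrow> countable B)"
proof (intro iffI conjI allI impI)
  show "below_first_measurable T" if "bisequential (X_space T lt)"
    using bisequential_imp_below_first_measurable[OF assms that] .
  show "countable B" if "bisequential (X_space T lt)" "branch T lt B" for B
    using bisequential_imp_countable_branch[OF assms that] .
  show "bisequential (X_space T lt)"
    if "below_first_measurable T \<and> (\<forall>B. branch T lt B \<longrightarrow> countable B)"
    using that by (intro bisequential_if_countable_branches[OF assms]) simp_all
qed

end
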